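(* Let $\mathcal{A}$ be a $3$-dimensional hypercomplex algebra over $\mathbb{R}$ with basis $\{\mathbf{i}_0=1,\mathbf{i}_1,\mathbf{i}_2\}$, and let $P_{\mathcal{A}}\in\mathbb{R}^{3\times 9}$ be its product matrix with respect to this ordered basis. Then $\mathcal{A}$ is a perfect hypercomplex algebra (i.e. is commutative and associative) if and only if there are real numbers $a,b,c,d,e,f,p,q,r$ such that $$P_{\mathcal{A}}=\begin{bmatrix} 1&0&0&0&a&d&0&d&p\\ 0&1&0&1&b&e&0&e&q\\ 0&0&1&0&c&f&1&f&r \end{bmatrix}$$ and $$a=ce+f^2-bf-cr,\qquad d=cq-ef,\qquad p=e^2+fq-bq-er.$$
   Context: An algebra over $\mathbb{R}$ is a real vector space $V$ with a bilinear product $*:V\times V\to V$ (not assumed commutative or associative). A hypercomplex algebra of dimension $n+1$ is an algebra $\mathcal{A}$ over $\mathbb{R}$ with a basis $\{\mathbf{i}_0=1,\mathbf{i}_1,\dots,\mathbf{i}_n\}$, where $1$ is a two-sided identity for $*$. It is a perfect hypercomplex algebra (PHA) if $*$ is commutative and associative. Product matrix: writing $\mathbf{i}_i*\mathbf{i}_j=\sum_{s=0}^{n}c^s_{i,j}\mathbf{i}_s$, the product matrix $P_{\mathcal{A}}$ is the $(n+1)\times(n+1)^2$ real matrix whose columns are indexed by pairs $(i,j)$, $0\le i,j\le n$, in lexicographic order $(0,0),(0,1),\dots,(0,n),(1,0),\dots,(n,n)$, the column with index $(i,j)$ being $(c^0_{i,j},c^1_{i,j},\dots,c^n_{i,j})^T$.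 For $n=2$ this is a $3\times 9$ matrix. *)

theory Defs
  imports "HOL-Analysis.Linear_Algebra" "Jordan_Normal_Form.Matrix"
begin

text \<open>The carrier of the algebra is the whole real vector space \<^typ>\<open>'a\<close>;
  \<open>mul\<close> is the product, and the basis vectors are \<open>b 0, ..., b n\<close>.\<close>

locale hypercomplex_algebra =
  fixes mul :: "'a::real_vector \<Rightarrow> 'a \<Rightarrow> 'a"
    and b :: "nat \<Rightarrow> 'a"
    and n :: nat
  assumes bilinear_mult: "bilinear mul"
    and inj_basis: "inj_on b {..n}"
    and independent_basis: "independent (b ` {..n})"
    and span_basis: "span (b ` {..n}) = UNIV"
    and left_one: "mul (b 0) x = x"
    and right_one: "mul x (b 0) = x"

locale perfect_hypercomplex_algebra = hypercomplex_algebra +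
  assumes mult_commute: "mul x y = mul y x"
    and mult_assoc: "mul (mul x y) z = mul x (mul y z)"

definition structure_constant ::
    "('a::real_vector \<Rightarrow> 'a \<Rightarrow> 'a) \<Rightarrow> (nat \<Rightarrow> 'a) \<Rightarrow> nat \<Rightarrow> nat \<Rightarrow> nat \<Rightarrow> nat \<Rightarrow> real" where
  "structure_constant mul b n s i j = representation (b ` {..n}) (mul (b i) (b j)) (b s)"

text \<open>Counting from 0, the pair \<open>(i, j)\<close> has position \<open>(n + 1) * i + j\<close>
  in the lexicographic order.\<close>

definition product_matrix ::
    "('a::real_vector \<Rightarrow> 'a \<Rightarrow> 'a) \<Rightarrow> (nat \<Rightarrow> 'a) \<Rightarrow> nat \<Rightarrow> real mat" where
  "product_matrix mul b n =
     mat (n + 1) ((n + 1)\<^sup>2) (\<lambda>(s, k). structure_constant mul b n s (k div (n + 1)) (k mod (n + 1)))"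

end

theory Submission imports Defs begin

text \<open>Writing \<open>u = i\<^sub>1\<close> and \<open>v = i\<^sub>2\<close>, the shape of the matrix says that \<open>1\<close> is the identity and
  \<open>u v = v u\<close>. The \<open>v\<close>- and \<open>u\<close>-coordinates of \<open>(u u) v = u (u v)\<close> are the conditions on
  \<open>a\<close> and \<open>d\<close>, and the \<open>u\<close>-coordinate of \<open>(u v) v = u (v v)\<close> is the condition on \<open>p\<close>.
  Conversely, once these are substituted, the coordinates of a general associator vanish
  as polynomials.\<close>

context hypercomplex_algebra
begin

text \<open>\<open>representation\<close> is indexed by vectors of a set. Injectivity of
  \<open>b\<close> moves the sum to indices, and spanning makes every vector admissible.\<close>

lemma sum_representation: "(\<Sum>s\<le>n. representation (b ` {..n}) x (b s) *\<^sub>R b s) = x"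
proof -
  have "(\<Sum>s\<le>n. representation (b ` {..n}) x (b s) *\<^sub>R b s)
      = (\<Sum>w\<in>b ` {..n}. representation (b ` {..n}) x w *\<^sub>R w)"
    by (simp add: sum.reindex[OF inj_basis])
  also have "\<dots> = x"
    by (rule real_vector.sum_representation_eq) (use independent_basis span_basis in auto)
  finally show ?thesis .
qed

lemma representation_sum:
  assumes "k \<le> n"
  shows "representation (b ` {..n}) (\<Sum>s\<le>n. c s *\<^sub>R b s) (b k) = c k"
proof -
  \<comment> \<open>Injectivity of \<open>b\<close> turns the Kronecker delta on basis vectors into
    one on indices.\<close>
  have "representation (b ` {..n}) (b s) (b k) = (if s = k then 1 else 0)" if "s \<le> n" for s
    using that assms inj_basis
    by (auto simp: real_vector.representation_basis[OF independent_basis] inj_on_def)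
  then have "(\<Sum>s\<le>n. c s * representation (b ` {..n}) (b s) (b k)) = (\<Sum>s\<le>n. if s = k then c s else 0)"
    by (intro sum.cong) auto
  then show ?thesis
    using assms
    by (simp add: real_vector.representation_sum[OF independent_basis]
        real_vector.representation_scale[OF independent_basis] span_basis)
qed

lemma mult_basis: "mul (b i) (b j) = (\<Sum>s\<le>n. structure_constant mul b n s i j *\<^sub>R b s)"
  by (simp add: structure_constant_def sum_representation)

end

lemma all_less_3: "(\<forall>s<3. P s) \<longleftrightarrow> P 0 \<and> P 1 \<and> P (2::nat)"
  by (simp add: numeral_eq_Suc All_less_Suc conj_ac)

lemma all_less_9: "(\<forall>k<9. P k) \<longleftrightarrow> P 0 \<and> P 1 \<and> P 2 \<and> P 3 \<and> P 4 \<and> P 5 \<and> P 6 \<and> P 7 \<and> P (8::nat)"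
  by (simp add: numeral_eq_Suc All_less_Suc conj_ac)

locale hypercomplex_algebra_3 = hypercomplex_algebra mul b 2
  for mul :: "'a::real_vector \<Rightarrow> 'a \<Rightarrow> 'a" and b :: "nat \<Rightarrow> 'a"
begin

text \<open>An opaque coordinate form: equalities and products are computed on real triples without
  expanding into basis vectors.\<close>

definition lincomb :: "real \<Rightarrow> real \<Rightarrow> real \<Rightarrow> 'a" where
  "lincomb x y z = x *\<^sub>R b 0 + y *\<^sub>R b 1 + z *\<^sub>R b 2"

lemma sum_atMost_2: "(\<Sum>s\<le>2. c s *\<^sub>R b s) = lincomb (c 0) (c 1) (c 2)"
  by (simp add: numeral_2_eq_2 lincomb_def)

lemma lincomb_cases:
  obtains x y z where "w = lincomb x y z"
  using sum_representation[of w] unfolding sum_atMost_2 by metis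

lemma lincomb_eq_iff: "lincomb x y z = lincomb x' y' z' \<longleftrightarrow> x = x' \<and> y = y' \<and> z = z'"
proof
  \<comment> \<open>Coordinates as a function of the index, so that
    \<open>representation_sum\<close> applies; the value past index 2 is never read.\<close>
  define c where "c = (\<lambda>x y z :: real. \<lambda>s :: nat. if s = 0 then x else if s = 1 then y else z)"
  have rep: "representation (b ` {..2}) (lincomb x y z) (b s) = c x y z s" if "s \<le> 2" for x y z s
    using representation_sum[OF that, of "c x y z"] by (simp add: sum_atMost_2 c_def)
  assume "lincomb x y z = lincomb x' y' z'"
  then have "c x y z s = c x' y' z' s" if "s \<le> 2" for s
    using rep[OF that, of x y z] rep[OF that, of x' y' z'] by simp
  from this[of 0] this[of 1] this[of 2] show "x = x' \<and> y = y' \<and> z = z'"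
    by (simp add: c_def)
qed simp

lemma mult_basis_lincomb:
  "mul (b i) (b j) = lincomb (structure_constant mul b 2 0 i j)
     (structure_constant mul b 2 1 i j) (structure_constant mul b 2 2 i j)"
  by (simp add: mult_basis sum_atMost_2)

text \<open>Trades the three entries of a matrix column for a single equation between
  vectors.\<close>

lemma structure_constants_iff:
  "structure_constant mul b 2 0 i j = x \<and> structure_constant mul b 2 1 i j = y \<and>
   structure_constant mul b 2 2 i j = z \<longleftrightarrow> mul (b i) (b j) = lincomb x y z"
  by (simp add: mult_basis_lincomb lincomb_eq_iff)

text \<open>Column \<open>3 * i + j\<close> holds the product of \<open>b i\<close> and
  \<open>b j\<close>. The five columns with a factor \<open>b 0\<close> are forced by the identity;
  columns 4, 5, 7 and 8 give the four products on the right. The entry \<open>k\<close> is so named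
  because \<open>b\<close> is the basis.\<close>

lemma product_matrix_eq_iff:
  "product_matrix mul b 2 = mat_of_rows_list 9
      [[1, 0, 0, 0, a, d, 0, d, p],
       [0, 1, 0, 1, k, e, 0, e, q],
       [0, 0, 1, 0, c, f, 1, f, r]] \<longleftrightarrow>
   mul (b 1) (b 1) = lincomb a k c \<and> mul (b 1) (b 2) = lincomb d e f \<and>
   mul (b 2) (b 1) = lincomb d e f \<and> mul (b 2) (b 2) = lincomb p q r"
  (is "?P = ?M \<longleftrightarrow> ?R")
proof -
  have "?P = ?M \<longleftrightarrow> (\<forall>s<3. \<forall>k<9. ?P $$ (s, k) = ?M $$ (s, k))"
    by (subst mat_eq_iff) (auto simp: product_matrix_def mat_of_rows_list_def)
  also have "\<dots> \<longleftrightarrow> ?R"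
  proof -
    have unit: "mul (b 0) (b 0) = lincomb 1 0 0" "mul (b 0) (b 1) = lincomb 0 1 0"
      "mul (b 0) (b 2) = lincomb 0 0 1" "mul (b 1) (b 0) = lincomb 0 1 0"
      "mul (b 2) (b 0) = lincomb 0 0 1"
      by (simp_all add: left_one right_one lincomb_def)
    \<comment> \<open>The five products with the identity become fifteen known matrix entries,
      leaving twelve equations.\<close>
    note unit[folded structure_constants_iff, simp]
    show ?thesis
      unfolding structure_constants_iff[symmetric] all_less_3 all_less_9
      by (simp add: product_matrix_def mat_of_rows_list_def conj_ac del: One_nat_def)
        (simp only: One_nat_def)
  qed
  finally show ?thesis .
qed

text \<open>Bilinear expansion; \<open>d\<close>, \<open>e\<close>, \<open>f\<close> multiply the
  symmetric factor \<open>y * z' + z * y'\<close> because the two mixed products agree.\<close>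

lemma mult_lincomb:
  assumes "mul (b 1) (b 1) = lincomb a k c" "mul (b 1) (b 2) = lincomb d e f"
    "mul (b 2) (b 1) = lincomb d e f" "mul (b 2) (b 2) = lincomb p q r"
  shows "mul (lincomb x y z) (lincomb x' y' z') =
    lincomb (x * x' + y * y' * a + (y * z' + z * y') * d + z * z' * p)
      (x * y' + y * x' + y * y' * k + (y * z' + z * y') * e + z * z' * q)
      (x * z' + z * x' + y * y' * c + (y * z' + z * y') * f + z * z' * r)"
  using assms bilinear_mult
  by (simp add: lincomb_def bilinear_ladd bilinear_radd bilinear_lmul bilinear_rmul
      left_one right_one algebra_simps)

end

theorem mainTheorem1:
  fixes mul :: "'a::real_vector \<Rightarrow> 'a \<Rightarrow> 'a"
    and basis :: "nat \<Rightarrow> 'a"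
  assumes "hypercomplex_algebra mul basis 2"
  shows "perfect_hypercomplex_algebra mul basis 2 \<longleftrightarrow>
    (\<exists>a b c d e f p q r :: real.
       product_matrix mul basis 2 = mat_of_rows_list 9
         [[1, 0, 0, 0, a, d, 0, d, p],
          [0, 1, 0, 1, b, e, 0, e, q],
          [0, 0, 1, 0, c, f, 1, f, r]] \<and>
       a = c * e + f\<^sup>2 - b * f - c * r \<and>
       d = c * q - e * f \<and>
       p = e\<^sup>2 + f * q - b * q - e * r)"
proof -
  interpret hypercomplex_algebra_3 mul basis
    using assms by (simp add: hypercomplex_algebra_3_def)
  show ?thesis
    unfolding product_matrix_eq_iff
  proof
    assume "perfect_hypercomplex_algebra mul basis 2"
    then interpret perfect_hypercomplex_algebra mul basis 2 .
    obtain a b c where uu: "mul (basis 1) (basis 1) = lincomb a b c"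
      by (rule lincomb_cases)
    obtain d e f where uv: "mul (basis 1) (basis 2) = lincomb d e f"
      by (rule lincomb_cases)
    obtain p q r where vv: "mul (basis 2) (basis 2) = lincomb p q r"
      by (rule lincomb_cases)
    \<comment> \<open>Commutativity makes columns 5 and 7 of the matrix coincide.\<close>
    have vu: "mul (basis 2) (basis 1) = lincomb d e f"
      using uv mult_commute by simp
    note mult = mult_lincomb[OF uu uv vu vv]
    have "a = c * e + f\<^sup>2 - b * f - c * r" "d = c * q - e * f"
      using mult_assoc[of "lincomb 0 1 0" "lincomb 0 1 0" "lincomb 0 0 1"]
      by (simp_all add: mult lincomb_eq_iff power2_eq_square algebra_simps)
    moreover have "p = e\<^sup>2 + f * q - b * q - e * r"
      using mult_assoc[of "lincomb 0 1 0" "lincomb 0 0 1" "lincomb 0 0 1"]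
      by (simp add: mult lincomb_eq_iff power2_eq_square algebra_simps)
    ultimately show "\<exists>a b c d e f p q r.
        (mul (basis 1) (basis 1) = lincomb a b c \<and> mul (basis 1) (basis 2) = lincomb d e f \<and>
         mul (basis 2) (basis 1) = lincomb d e f \<and> mul (basis 2) (basis 2) = lincomb p q r) \<and>
        a = c * e + f\<^sup>2 - b * f - c * r \<and> d = c * q - e * f \<and> p = e\<^sup>2 + f * q - b * q - e * r"
      using uu uv vu vv by blast
  next
    assume "\<exists>a b c d e f p q r.
        (mul (basis 1) (basis 1) = lincomb a b c \<and> mul (basis 1) (basis 2) = lincomb d e f \<and>
         mul (basis 2) (basis 1) = lincomb d e f \<and> mul (basis 2) (basis 2) = lincomb p q r) \<and>
        a = c * e + f\<^sup>2 - b * f - c * r \<and> d = c * q - e * f \<and> p = e\<^sup>2 + f * q - b * q - e * r"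
    then obtain a b c d e f p q r where prods:
        "mul (basis 1) (basis 1) = lincomb a b c" "mul (basis 1) (basis 2) = lincomb d e f"
        "mul (basis 2) (basis 1) = lincomb d e f" "mul (basis 2) (basis 2) = lincomb p q r"
      and a: "a = c * e + f\<^sup>2 - b * f - c * r" and d: "d = c * q - e * f"
      and p: "p = e\<^sup>2 + f * q - b * q - e * r"
      by blast
    note mult = mult_lincomb[OF prods]
    show "perfect_hypercomplex_algebra mul basis 2"
    proof
      fix x y z
      obtain x0 x1 x2 where x: "x = lincomb x0 x1 x2" by (rule lincomb_cases)
      obtain y0 y1 y2 where y: "y = lincomb y0 y1 y2" by (rule lincomb_cases)
      obtain z0 z1 z2 where z: "z = lincomb z0 z1 z2" by (rule lincomb_cases)
      show "mul x y = mul y x"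
        \<comment> \<open>Each coordinate in the product formula is unchanged when the two factors
          are swapped.\<close>
        by (simp add: x y mult lincomb_eq_iff algebra_simps)
      show "mul (mul x y) z = mul x (mul y z)"
        \<comment> \<open>The right-hand sides for \<open>a\<close>, \<open>d\<close>,
          \<open>p\<close> involve only \<open>b\<close>, \<open>c\<close>, \<open>e\<close>,
          \<open>f\<close>, \<open>q\<close>, \<open>r\<close>, so substitution leaves polynomial
          identities in these six parameters and the nine coordinates.\<close>
        unfolding x y z mult lincomb_eq_iff a d p 
        by (intro conjI; simp add: algebra_simps power2_eq_square)
    qed
  qed
qed

end
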